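(* Let $(B,+,\cdot)$ be a skew left brace with additive group $K=(B,+)$ and multiplicative group $C=(B,\cdot)$. Let $(G_i,K_i,H_i,E_i)$, $i=1,2$, be two trifactorised groups associated with $B$ with corresponding epimorphisms $\eta_i\colon C\to E_i$. If $\ker\eta_1\le\ker\eta_2$, then $(G_2,K_2,H_2,E_2)$ is a quotient of $(G_1,K_1,H_1,E_1)$. In particular: (1) every trifactorised group associated with $B$ is a quotient of the large trifactorised group $\mathsf{L}(B,+,\cdot)$; (2) every trifactorised group associated with $B$ has the small trifactorised group $\mathsf{S}(B,+,\cdot)$ as a quotient.
   Context: A skew left brace $(B,+,\cdot)$ is a set with two group operations ($+$ not necessarily commutative) such that $a(b+c)=ab-a+ac$ for all $a,b,c\in B$. Its lambda map is the homomorphism $\lambda\colon (B,\cdot)\to\operatorname{Aut}(B,+)$, $\lambda_a(b)=-a+ab$. A trifactorised group is a tuple $(G,K,H,E)$ with $G$ a group, $K\trianglelefteq G$, $H,E\le G$, $G=KE=KH=HE$ and $K\cap E=H\cap E=1$. A morphism of trifactorised groups is a homomorphism of the ambient groups mapping each of the three subgroups of the source into the corresponding subgroup of the target; an isomorphism is a bijective morphism. Trifactorised groups associated with a brace: let $K=(B,+)$, $C=(B,\cdot)$, let $\delta\colon C\to K$ be the identity map of $B$, and let $\eta\colon C\to E$ be a surjective group homomorphism with $\ker\eta\le\ker\lambda$. Then $E$ acts on $K$ by $\bar\lambda(\eta(c))=\lambda(c)$; put $G=K\rtimes E$ (with $K$, $E$ identified with their copies in $G$) and $H=\{\delta(c)\eta(c)\mid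 c\in C\}\le G$. The tuple $(G,K,H,E)$ is the trifactorised group associated with $B$ with corresponding epimorphism $\eta$. The large trifactorised group $\mathsf{L}(B,+,\cdot)$ is the one obtained from $\eta=\operatorname{id}_C$. The small trifactorised group is $\mathsf{S}(B,+,\cdot)=(S,K,H,E)$, where inside $\operatorname{Hol}(K)=K\rtimes\operatorname{Aut}(K)$ one takes $H=\{(a,\lambda_a)\mid a\in B\}$, $E=\{(0,\lambda_b)\mid b\in B\}$ and $S=KH$; i.e. the one obtained from $\eta=\lambda\colon C\to\lambda(C)$. A trifactorised group is a quotient of $(G,K,H,E)$ if it is isomorphic to $(G/T,KT/T,HT/T,ET/T)$ for some normal subgroup $T$ of $G$ for which this latter tuple is a trifactorised group. *)

theory Defs
  imports "HOL-Algebra.Coset" "HOL-Algebra.Bij" "HOL-Algebra.Ring"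
begin

section \<open>Skew left braces\<close>

text \<open>
  A skew left brace is carried by a record of type \<open>'a ring\<close>: its additive group is
  \<^term>\<open>add_monoid B\<close> (not assumed to be abelian) and its multiplicative group is the
  \<open>monoid\<close> part of the record, i.e. \<open>B\<close> itself.
\<close>

locale skew_left_brace =
  fixes B (structure)
  assumes add_group: "group (add_monoid B)"
    and mult_group: "group B"
    and brace_law: "\<lbrakk>a \<in> carrier B; b \<in> carrier B; c \<in> carrier B\<rbrakk>
      \<Longrightarrow> a \<otimes> (b \<oplus> c) = a \<otimes> b \<ominus> a \<oplus> a \<otimes> c"

text \<open>As required by \<^const>\<open>AutoGroup\<close>, the maps are extensional on the carrier.\<close>

definition lam :: "('a, 'm) ring_scheme \<Rightarrow> 'a \<Rightarrow> 'a \<Rightarrow> 'a" where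
  "lam B a = (\<lambda>b\<in>carrier B. \<ominus>\<^bsub>B\<^esub> a \<oplus>\<^bsub>B\<^esub> a \<otimes>\<^bsub>B\<^esub> b)"


section \<open>Trifactorised groups\<close>

locale trifactorised_group = group G for G (structure) +
  fixes K H E
  assumes K_normal: "K \<lhd> G"
    and H_subgroup: "subgroup H G"
    and E_subgroup: "subgroup E G"
    and KE: "carrier G = K <#> E"
    and KH: "carrier G = K <#> H"
    and HE: "carrier G = H <#> E"
    and K_Int_E: "K \<inter> E = {\<one>}"
    and H_Int_E: "H \<inter> E = {\<one>}"

type_synonym 'g quad = "'g monoid \<times> 'g set \<times> 'g set \<times> 'g set"

fun trifactorised :: "'g quad \<Rightarrow> bool" where
  "trifactorised (G, K, H, E) \<longleftrightarrow> trifactorised_group G K H E"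

fun trifact_hom :: "'g quad \<Rightarrow> 'h quad \<Rightarrow> ('g \<Rightarrow> 'h) set" where
  "trifact_hom (G, K, H, E) (G', K', H', E') =
     {f \<in> hom G G'. f ` K \<subseteq> K' \<and> f ` H \<subseteq> H' \<and> f ` E \<subseteq> E'}"

definition trifact_iso :: "'g quad \<Rightarrow> 'h quad \<Rightarrow> ('g \<Rightarrow> 'h) set" where
  "trifact_iso X Y = {f \<in> trifact_hom X Y. bij_betw f (carrier (fst X)) (carrier (fst Y))}"

text \<open>
  The tuple \<open>(G/T, KT/T, HT/T, ET/T)\<close>; e.g. \<open>KT/T\<close> is the set of cosets of \<open>T\<close> in
  the subgroup \<open>KT\<close>.
\<close>

fun quotient_quad :: "'g quad \<Rightarrow> 'g set \<Rightarrow> 'g set quad" where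
  "quotient_quad (G, K, H, E) T =
     (G Mod T,
      rcosets\<^bsub>G\<lparr>carrier := K <#>\<^bsub>G\<^esub> T\<rparr>\<^esub> T,
      rcosets\<^bsub>G\<lparr>carrier := H <#>\<^bsub>G\<^esub> T\<rparr>\<^esub> T,
      rcosets\<^bsub>G\<lparr>carrier := E <#>\<^bsub>G\<^esub> T\<rparr>\<^esub> T)"

definition is_trifact_quotient :: "'h quad \<Rightarrow> 'g quad \<Rightarrow> bool"
    (infix \<open>is'_trifact'_quotient'_of\<close> 50) where
  "X is_trifact_quotient_of Y \<longleftrightarrow>
     trifactorised X \<and> trifactorised Y \<and>
     (\<exists>T. T \<lhd> fst Y \<and> trifactorised (quotient_quad Y T) \<and>
          trifact_iso X (quotient_quad Y T) \<noteq> {})"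


section \<open>Trifactorised groups associated with a skew left brace\<close>

definition semidirect ::
    "('k, 'm) monoid_scheme \<Rightarrow> ('e, 'n) monoid_scheme \<Rightarrow> ('e \<Rightarrow> 'k \<Rightarrow> 'k) \<Rightarrow> ('k \<times> 'e) monoid" where
  "semidirect K E \<phi> =
     \<lparr>carrier = carrier K \<times> carrier E,
      mult = (\<lambda>(a, x) (b, y). (a \<otimes>\<^bsub>K\<^esub> \<phi> x b, x \<otimes>\<^bsub>E\<^esub> y)),
      one = (\<one>\<^bsub>K\<^esub>, \<one>\<^bsub>E\<^esub>)\<rparr>"

definition Hol :: "('k, 'm) monoid_scheme \<Rightarrow> ('k \<times> ('k \<Rightarrow> 'k)) monoid" where
  "Hol K = semidirect K (AutoGroup K) (\<lambda>f. f)"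

definition associated_epi :: "('a, 'm) ring_scheme \<Rightarrow> ('e, 'n) monoid_scheme \<Rightarrow> ('a \<Rightarrow> 'e) \<Rightarrow> bool" where
  "associated_epi B E \<eta> \<longleftrightarrow>
     group E \<and> \<eta> \<in> epi B E \<and>
     kernel B E \<eta> \<subseteq> kernel B (AutoGroup (add_monoid B)) (lam B)"

text \<open>
  The action of \<open>E\<close> sending \<open>\<eta> c\<close> to \<^term>\<open>lam B c\<close>. The image of the fibre of \<open>\<eta>\<close>
  over \<open>e\<close> under \<^term>\<open>lam B\<close> is a singleton when \<^prop>\<open>associated_epi B E \<eta>\<close> and
  \<open>e\<close> is in the carrier of \<open>E\<close>; see \<open>lam_bar_eq\<close> below.
\<close>

definition lam_bar :: "('a, 'm) ring_scheme \<Rightarrow> ('a \<Rightarrow> 'e) \<Rightarrow> 'e \<Rightarrow> 'a \<Rightarrow> 'a" where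
  "lam_bar B \<eta> e = the_elem (lam B ` {c \<in> carrier B. \<eta> c = e})"

text \<open>
  The pair \<open>(c, \<eta> c)\<close> is the product \<open>\<delta>(c)\<eta>(c)\<close> of \<open>(c, 1)\<close> and \<open>(0, \<eta> c)\<close> in the
  semidirect product, \<open>\<delta>\<close> being the identity map of \<open>B\<close>.
\<close>

definition associated_quad ::
    "('a, 'm) ring_scheme \<Rightarrow> ('e, 'n) monoid_scheme \<Rightarrow> ('a \<Rightarrow> 'e) \<Rightarrow> ('a \<times> 'e) quad" where
  "associated_quad B E \<eta> =
     (semidirect (add_monoid B) E (lam_bar B \<eta>),
      carrier B \<times> {\<one>\<^bsub>E\<^esub>},
      {(c, \<eta> c) | c. c \<in> carrier B},
      {\<zero>\<^bsub>B\<^esub>} \<times> carrier E)"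

definition large_quad :: "('a, 'm) ring_scheme \<Rightarrow> ('a \<times> 'a) quad" where
  "large_quad B = associated_quad B B id"

definition small_quad :: "('a, 'm) ring_scheme \<Rightarrow> ('a \<times> ('a \<Rightarrow> 'a)) quad" where
  "small_quad B =
     (let L = Hol (add_monoid B);
          K = carrier B \<times> {\<one>\<^bsub>AutoGroup (add_monoid B)\<^esub>};
          H = {(a, lam B a) | a. a \<in> carrier B};
          E = {(\<zero>\<^bsub>B\<^esub>, lam B b) | b. b \<in> carrier B}
      in (L\<lparr>carrier := K <#>\<^bsub>L\<^esub> H\<rparr>, K, H, E))"


section \<open>Consistency of the definitions\<close>

context skew_left_brace
begin

interpretation A: group "add_monoid B"
  rewrites "carrier (add_monoid B) = carrier B"
    and "mult (add_monoid B) = add B"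
    and "one (add_monoid B) = zero B"
    and "m_inv (add_monoid B) = a_inv B"
  by (simp_all add: add_group a_inv_def)

interpretation M: group B
  by (rule mult_group)

lemma lam_closed: "\<lbrakk>a \<in> carrier B; b \<in> carrier B\<rbrakk> \<Longrightarrow> lam B a b \<in> carrier B"
  by (simp add: lam_def)

lemma lam_extensional: "lam B a \<in> extensional (carrier B)"
  by (simp add: lam_def)

lemma lam_add:
  assumes "a \<in> carrier B" "b \<in> carrier B" "c \<in> carrier B"
  shows "lam B a (b \<oplus> c) = lam B a b \<oplus> lam B a c"
  using assms by (simp add: lam_def brace_law a_minus_def A.m_assoc)

lemma mult_conv_lam:
  assumes "a \<in> carrier B" "b \<in> carrier B"
  shows "a \<otimes> b = a \<oplus> lam B a b"
  using assms by (simp add: lam_def A.m_assoc [symmetric])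

lemma lam_mult:
  assumes "a \<in> carrier B" "b \<in> carrier B" "c \<in> carrier B"
  shows "lam B (a \<otimes> b) c = lam B a (lam B b c)"
proof -
  have "a \<otimes> b \<oplus> lam B (a \<otimes> b) c = a \<otimes> (b \<otimes> c)"
    using assms mult_conv_lam [of "a \<otimes> b" c] by (simp add: M.m_assoc)
  also have "\<dots> = a \<otimes> (b \<oplus> lam B b c)"
    using assms by (simp add: mult_conv_lam)
  also have "\<dots> = a \<oplus> lam B a (b \<oplus> lam B b c)"
    using assms lam_closed by (intro mult_conv_lam) auto
  also have "\<dots> = a \<oplus> (lam B a b \<oplus> lam B a (lam B b c))"
    using assms lam_closed by (simp add: lam_add)
  also have "\<dots> = a \<otimes> b \<oplus> lam B a (lam B b c)"
    using assms lam_closed by (simp add: mult_conv_lam A.m_assoc)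
  finally show ?thesis
    using assms lam_closed by simp
qed

lemma zero_eq_one: "\<zero> = \<one>"
proof -
  have "\<one> \<otimes> (\<one> \<oplus> \<zero>) = \<one> \<otimes> \<one> \<ominus> \<one> \<oplus> \<one> \<otimes> \<zero>"
    by (rule brace_law) auto
  then show ?thesis
    by (simp add: a_minus_def)
qed

lemma lam_one: "b \<in> carrier B \<Longrightarrow> lam B \<one> b = b"
  using zero_eq_one A.l_one A.inv_one by (simp add: lam_def)

lemma bij_lam:
  assumes "a \<in> carrier B"
  shows "bij_betw (lam B a) (carrier B) (carrier B)"
proof (rule bij_betw_byWitness [where f' = "lam B (inv a)"])
  show "\<forall>b\<in>carrier B. lam B (inv a) (lam B a b) = b"
    using assms by (simp add: lam_one flip: lam_mult)
  show "\<forall>b\<in>carrier B. lam B a (lam B (inv a) b) = b"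
    using assms by (simp add: lam_one flip: lam_mult)
qed (use assms lam_closed in auto)

lemma lam_in_auto: "a \<in> carrier B \<Longrightarrow> lam B a \<in> auto (add_monoid B)"
  using bij_lam [of a] by (simp add: auto_def hom_def Bij_def lam_closed lam_add lam_extensional)

lemma lam_hom: "lam B \<in> hom B (AutoGroup (add_monoid B))"
proof (rule homI)
  show "lam B a \<in> carrier (AutoGroup (add_monoid B))" if "a \<in> carrier B" for a
    using that lam_in_auto by (simp add: AutoGroup_def)
  show "lam B (a \<otimes> b) = lam B a \<otimes>\<^bsub>AutoGroup (add_monoid B)\<^esub> lam B b"
    if "a \<in> carrier B" "b \<in> carrier B" for a b
  proof -
    have "lam B a \<in> Bij (carrier B)" "lam B b \<in> Bij (carrier B)"
      using that lam_in_auto by (auto simp: auto_def)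
    moreover have "lam B (a \<otimes> b) x = compose (carrier B) (lam B a) (lam B b) x" for x
      using that lam_mult [of a b x] by (cases "x \<in> carrier B") (auto simp: compose_def lam_def)
    ultimately show ?thesis
      by (auto simp: AutoGroup_def BijGroup_def)
  qed
qed

lemma lam_bar_eq:
  assumes "associated_epi B E \<eta>" "c \<in> carrier B"
  shows "lam_bar B \<eta> (\<eta> c) = lam B c"
proof -
  interpret E: group E
    using assms by (simp add: associated_epi_def)
  interpret AG: group "AutoGroup (add_monoid B)"
    by (rule A.AutoGroup)
  interpret eta: group_hom B E \<eta>
    using assms by unfold_locales (simp add: associated_epi_def epi_def)
  interpret lam: group_hom B "AutoGroup (add_monoid B)" "lam B"
    by unfold_locales (rule lam_hom)
  have "lam B d = lam B c" if d: "d \<in> carrier B" "\<eta> d = \<eta> c" for d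
  proof -
    have "d \<otimes> inv c \<in> kernel B E \<eta>"
      using d assms by (simp add: kernel_def)
    then have "d \<otimes> inv c \<in> kernel B (AutoGroup (add_monoid B)) (lam B)"
      using assms by (auto simp: associated_epi_def)
    then have "lam B (d \<otimes> inv c) = \<one>\<^bsub>AutoGroup (add_monoid B)\<^esub>"
      by (simp add: kernel_def)
    then have "lam B (d \<otimes> inv c \<otimes> c) = lam B c"
      using d assms(2) by (simp only: lam.hom_mult M.inv_closed M.m_closed AG.l_one lam.hom_closed)
    moreover have "d \<otimes> inv c \<otimes> c = d"
      using d assms(2) by (simp add: M.m_assoc)
    ultimately show ?thesis
      by simp
  qed
  then have "lam B ` {d \<in> carrier B. \<eta> d = \<eta> c} = {lam B c}"
    using assms(2) by blast
  then show ?thesis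
    by (simp add: lam_bar_def)
qed

lemma large_epi: "associated_epi B B id"
proof -
  interpret AG: group "AutoGroup (add_monoid B)"
    by (rule A.AutoGroup)
  interpret lam: group_hom B "AutoGroup (add_monoid B)" "lam B"
    by unfold_locales (rule lam_hom)
  show ?thesis
    using lam.hom_one by (auto simp: associated_epi_def mult_group epi_def hom_def kernel_def)
qed

abbreviation lam_image :: "('a \<Rightarrow> 'a) monoid" where
  "lam_image \<equiv> (AutoGroup (add_monoid B)) \<lparr>carrier := lam B ` carrier B\<rparr>"

lemma small_epi: "associated_epi B lam_image (lam B)"
proof -
  interpret AG: group "AutoGroup (add_monoid B)"
    by (rule A.AutoGroup)
  interpret lam: group_hom B "AutoGroup (add_monoid B)" "lam B"
    by unfold_locales (rule lam_hom)
  have "group lam_image"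
    by (rule subgroup.subgroup_is_group [OF lam.img_is_subgroup AG.group_axioms])
  moreover have "lam B \<in> epi B lam_image"
    using lam_hom by (auto simp: epi_def hom_def)
  ultimately show ?thesis
    by (simp add: associated_epi_def kernel_def)
qed

lemma one_Auto: "b \<in> carrier B \<Longrightarrow> \<one>\<^bsub>AutoGroup (add_monoid B)\<^esub> b = b"
  by (simp add: AutoGroup_def BijGroup_def)

text \<open>
  The two ambient groups have the same carrier and their products agree on it, but they are
  not equal as records, as their products may differ off the carrier.
\<close>

lemma small_iso_associated:
  "(\<lambda>x. x) \<in> trifact_iso (small_quad B) (associated_quad B lam_image (lam B))"
proof -
  interpret AG: group "AutoGroup (add_monoid B)"
    by (rule A.AutoGroup)
  interpret lam: group_hom B "AutoGroup (add_monoid B)" "lam B"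
    by unfold_locales (rule lam_hom)
  let ?L = "Hol (add_monoid B)"
  have KH: "carrier B \<times> {\<one>\<^bsub>AutoGroup (add_monoid B)\<^esub>} <#>\<^bsub>?L\<^esub> {(a, lam B a) | a. a \<in> carrier B}
      = carrier B \<times> lam B ` carrier B" (is "?KH = _")
  proof (intro equalityI subsetI)
    fix p assume "p \<in> ?KH"
    then obtain a b where ab: "a \<in> carrier B" "b \<in> carrier B"
      and p: "p = (a \<oplus> \<one>\<^bsub>AutoGroup (add_monoid B)\<^esub> b, \<one>\<^bsub>AutoGroup (add_monoid B)\<^esub> \<otimes>\<^bsub>AutoGroup (add_monoid B)\<^esub> lam B b)"
      by (auto simp: set_mult_def Hol_def semidirect_def)
    then show "p \<in> carrier B \<times> lam B ` carrier B"
      by (simp add: one_Auto)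
  next
    fix p assume "p \<in> carrier B \<times> lam B ` carrier B"
    then obtain a b where ab: "a \<in> carrier B" "b \<in> carrier B" and p: "p = (a, lam B b)"
      by auto
    then have "p = (a \<oplus> \<ominus> b, \<one>\<^bsub>AutoGroup (add_monoid B)\<^esub>) \<otimes>\<^bsub>?L\<^esub> (b, lam B b)"
      by (simp add: Hol_def semidirect_def one_Auto A.m_assoc)
    with ab show "p \<in> ?KH"
      by (force simp: set_mult_def)
  qed
  have bar: "lam_bar B (lam B) (lam B c) = lam B c" if "c \<in> carrier B" for c
    using that lam_bar_eq small_epi by blast
  have "(\<lambda>x. x) \<in> hom (?L\<lparr>carrier := ?KH\<rparr>) (semidirect (add_monoid B) lam_image (lam_bar B (lam B)))"
    unfolding KH by (rule homI) (auto simp: Hol_def semidirect_def bar)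
  then show ?thesis
    by (auto simp: trifact_iso_def small_quad_def associated_quad_def Let_def KH semidirect_def bij_betw_def)
qed

end

end

theory Submission
  imports Defs
begin

text \<open>
  If \<open>ker \<eta>\<^sub>1 \<le> ker \<eta>\<^sub>2\<close>, then \<open>\<eta>\<^sub>2 = \<psi> \<circ> \<eta>\<^sub>1\<close> for a unique
  homomorphism \<open>\<psi>\<close> from \<open>E\<^sub>1\<close> onto \<open>E\<^sub>2\<close> (\<open>epi_factorisation\<close>). An element
  \<open>\<eta>\<^sub>1 c\<close> of \<open>E\<^sub>1\<close> and its image \<open>\<eta>\<^sub>2 c\<close> both act on \<open>K\<close> as \<open>\<lambda>\<^sub>c\<close>, so
  \<open>(a, e) \<mapsto> (a, \<psi> e)\<close> is a homomorphism of the semidirect products; it maps \<open>K\<^sub>1\<close>, \<open>H\<^sub>1\<close>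
  and \<open>E\<^sub>1\<close> onto \<open>K\<^sub>2\<close>, \<open>H\<^sub>2\<close> and \<open>E\<^sub>2\<close> (\<open>associated_quotient\<close>).

  A homomorphism that is onto on each of the three subgroups exhibits its target as the
  quotient of its source by the kernel, provided that source and target are both
  trifactorised (\<open>trifact_quotient_of_surjection\<close>). This is the first isomorphism theorem:
  the isomorphism from \<open>G'\<close> to \<open>G/T\<close> carries \<open>K'\<close>, \<open>H'\<close> and \<open>E'\<close> onto
  \<open>KT/T\<close>, \<open>HT/T\<close> and \<open>ET/T\<close>. Being trifactorised is invariant under isomorphism, so the
  quotient tuple inherits it from the target. That the
  tuples associated with \<open>B\<close> are trifactorised is shown in \<open>trifactorised_associated_quad\<close>.

  The two special cases are the extreme kernels. The large group belongs to \<open>\<eta> = id\<close>,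
  whose kernel is trivial. The small group is, up to an identity map between two
  presentations of the same group, the one belonging to \<open>\<eta> = \<lambda>\<close>, and \<open>ker \<lambda>\<close>
  contains every admissible kernel by definition.
\<close>

section \<open>Surjective homomorphisms and quotients\<close>

text \<open>
  The first isomorphism theorem, read from the image to the quotient. Knowing the value at
  \<open>h g\<close> makes it possible to compute images of subgroups under \<open>\<phi>\<close>.
\<close>

lemma (in group_hom) iso_quotient_by_kernel:
  assumes surj: "h ` carrier G = carrier H"
  obtains \<phi> where "\<phi> \<in> iso H (G Mod kernel G H h)"
    and "\<And>g. g \<in> carrier G \<Longrightarrow> \<phi> (h g) = kernel G H h #> g"
proof -
  let ?T = "kernel G H h" and ?\<theta> = "\<lambda>X. the_elem (h ` X)"
  let ?\<phi> = "inv_into (carrier (G Mod ?T)) ?\<theta>"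
  have iso: "?\<theta> \<in> iso (G Mod ?T) H"
    by (rule FactGroup_iso_set [OF surj])
  have "?\<phi> (h g) = ?T #> g" if g: "g \<in> carrier G" for g
  proof -
    have mem: "?T #> g \<in> carrier (G Mod ?T)"
      using g by (auto simp: FactGroup_def RCOSETS_def)
    have "h ` (?T #> g) \<subseteq> {h g}"
      using g by (auto simp: r_coset_def kernel_def)
    moreover have "g \<in> ?T #> g"
      by (rule G.rcos_self [OF g subgroup_kernel])
    ultimately have "h ` (?T #> g) = {h g}"
      by blast
    then have "?\<theta> (?T #> g) = h g"
      by simp
    moreover have "inj_on ?\<theta> (carrier (G Mod ?T))"
      by (rule FactGroup_inj_on)
    ultimately show ?thesis
      using mem by (intro inv_into_f_eq)
  qed
  moreover have "?\<phi> \<in> iso H (G Mod ?T)"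
    by (rule group.iso_set_sym [OF normal.factorgroup_is_group [OF normal_kernel] iso])
  ultimately show ?thesis
    using that by blast
qed

text \<open>
  Both maps are compared with the quotient of \<open>G\<close> by the smaller kernel: \<open>H\<close> is isomorphic
  to it, and \<open>g\<close> descends to it.
\<close>

lemma epi_factorisation:
  assumes "group G" "group H" "group L"
    and f: "f \<in> epi G H" and g: "g \<in> hom G L" and ker: "kernel G H f \<subseteq> kernel G L g"
  obtains \<psi> where "\<psi> \<in> hom H L" "\<And>x. x \<in> carrier G \<Longrightarrow> \<psi> (f x) = g x"
proof -
  interpret f: group_hom G H f
    using assms by (simp add: group_hom_def group_hom_axioms_def epi_def)
  interpret g: group_hom G L g
    using assms by (simp add: group_hom_def group_hom_axioms_def)
  obtain \<phi> where \<phi>: "\<phi> \<in> iso H (G Mod kernel G H f)"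
    "\<And>x. x \<in> carrier G \<Longrightarrow> \<phi> (f x) = kernel G H f #>\<^bsub>G\<^esub> x"
    using f.iso_quotient_by_kernel f by (auto simp: epi_def)
  obtain \<gamma> where \<gamma>: "\<gamma> \<in> hom (G Mod kernel G H f) L"
    "\<And>x. x \<in> carrier G \<Longrightarrow> \<gamma> (kernel G H f #>\<^bsub>G\<^esub> x) = g x"
    using g.FactGroup_universal_kernel [OF f.normal_kernel ker] by blast
  show ?thesis
  proof (rule that)
    show "\<gamma> \<circ> \<phi> \<in> hom H L"
      using \<phi>(1) \<gamma>(1) hom_compose by (auto simp: iso_def)
  qed (simp add: \<phi>(2) \<gamma>(2))
qed


section \<open>Trifactorised groups under homomorphisms\<close>

lemma (in trifactorised_group) factors_subset:
  shows "K \<subseteq> carrier G" "H \<subseteq> carrier G" "E \<subseteq> carrier G"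
  using normal_imp_subgroup [OF K_normal] H_subgroup E_subgroup
  by (simp_all add: subgroup.subset)

text \<open>
  Surjectivity transports normality and the three factorisations; injectivity is what
  makes the trivial intersections survive.
\<close>

lemma (in trifactorised_group) iso_image_trifactorised:
  assumes G': "group G'" and f: "f \<in> iso G G'"
  shows "trifactorised_group G' (f ` K) (f ` H) (f ` E)"
proof -
  interpret f: group_hom G G' f
    by (intro group_hom.intro group_hom_axioms.intro group_axioms G' iso_imp_homomorphism f)
  have surj: "f ` carrier G = carrier G'" and inj: "inj_on f (carrier G)"
    using f by (auto simp: iso_iff)
  note sub = factors_subset
  show ?thesis
  proof (intro trifactorised_group.intro trifactorised_group_axioms.intro G')
    show "f ` K \<lhd> G'"
      using normal.surj_hom_normal_subgroup [OF K_normal f.group_hom_axioms surj] .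
    show "subgroup (f ` H) G'" "subgroup (f ` E) G'"
      using H_subgroup E_subgroup by (auto intro: f.subgroup_img_is_subgroup)
    show "carrier G' = f ` K <#>\<^bsub>G'\<^esub> f ` E"
      using set_mult_hom [OF f.homh sub(1,3)] KE surj by simp
    show "carrier G' = f ` K <#>\<^bsub>G'\<^esub> f ` H"
      using set_mult_hom [OF f.homh sub(1,2)] KH surj by simp
    show "carrier G' = f ` H <#>\<^bsub>G'\<^esub> f ` E"
      using set_mult_hom [OF f.homh sub(2,3)] HE surj by simp
    show "f ` K \<inter> f ` E = {\<one>\<^bsub>G'\<^esub>}"
      using inj_on_image_Int [OF inj sub(1,3)] K_Int_E by simp
    show "f ` H \<inter> f ` E = {\<one>\<^bsub>G'\<^esub>}"
      using inj_on_image_Int [OF inj sub(2,3)] H_Int_E by simp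
  qed
qed

text \<open>
  Intersections need not stay trivial in an arbitrary quotient, so the quotient tuple is
  recognised as trifactorised only through its isomorphism with the target.
\<close>

lemma trifact_quotient_of_surjection:
  assumes Y: "trifactorised_group G K H E" and X: "trifactorised_group G' K' H' E'"
    and f: "f \<in> hom G G'" "f ` K = K'" "f ` H = H'" "f ` E = E'"
  shows "(G', K', H', E') is_trifact_quotient_of (G, K, H, E)"
proof -
  interpret Y: trifactorised_group G K H E by (rule Y)
  interpret X: trifactorised_group G' K' H' E' by (rule X)
  interpret f: group_hom G G' f
    by unfold_locales (rule f)
  let ?T = "kernel G G' f"
  interpret T: normal ?T G
    by (rule f.normal_kernel)
  note sub = Y.factors_subset
  have surj: "f ` carrier G = carrier G'"
    using set_mult_hom [OF f(1) sub(1,3)] f X.KE Y.KE by simp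
  obtain \<phi> where \<phi>: "\<phi> \<in> iso G' (G Mod ?T)"
    and \<phi>_f: "\<And>g. g \<in> carrier G \<Longrightarrow> \<phi> (f g) = ?T #>\<^bsub>G\<^esub> g"
    using f.iso_quotient_by_kernel [OF surj] by blast
  \<comment> \<open>Since \<open>f (UT) = f U\<close>, the subgroup \<open>UT/T\<close> is the image of \<open>f U\<close> under \<open>\<phi>\<close>.\<close>
  have img: "rcosets\<^bsub>G\<lparr>carrier := U <#>\<^bsub>G\<^esub> ?T\<rparr>\<^esub> ?T = \<phi> ` f ` U" if "U \<subseteq> carrier G" for U
  proof -
    have UT: "U <#>\<^bsub>G\<^esub> ?T \<subseteq> carrier G"
      by (rule Y.set_mult_closed [OF that T.subset])
    have "rcosets\<^bsub>G\<lparr>carrier := U <#>\<^bsub>G\<^esub> ?T\<rparr>\<^esub> ?T = (\<lambda>g. ?T #>\<^bsub>G\<^esub> g) ` (U <#>\<^bsub>G\<^esub> ?T)"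
      by (auto simp: RCOSETS_def r_coset_def)
    also have "\<dots> = (\<lambda>g. \<phi> (f g)) ` (U <#>\<^bsub>G\<^esub> ?T)"
      using UT by (intro image_cong) (auto simp: \<phi>_f)
    also have "\<dots> = \<phi> ` f ` (U <#>\<^bsub>G\<^esub> ?T)"
      by (simp add: image_image)
    also have "\<dots> = \<phi> ` f ` U"
      using f.set_mult_ker_hom(1) [OF that] by simp
    finally show ?thesis .
  qed
  have quot: "quotient_quad (G, K, H, E) ?T = (G Mod ?T, \<phi> ` K', \<phi> ` H', \<phi> ` E')"
    using sub f by (simp add: img)
  have "trifactorised (quotient_quad (G, K, H, E) ?T)"
    unfolding quot using X.iso_image_trifactorised [OF T.factorgroup_is_group \<phi>] by simp
  moreover have "\<phi> \<in> trifact_iso (G', K', H', E') (quotient_quad (G, K, H, E) ?T)"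
    unfolding quot using \<phi> by (simp add: trifact_iso_def iso_def)
  ultimately show ?thesis
    unfolding is_trifact_quotient_def using X Y T.normal_axioms by auto
qed

text \<open>
  The hypothesis on the neutral element makes \<open>G'\<close> a group: an element of
  \<^term>\<open>iso G G'\<close> controls only the carrier and the product of \<open>G'\<close>.
\<close>

lemma trifact_quotient_iso:
  assumes quot: "(G, K, H, E) is_trifact_quotient_of Y"
    and iso: "f \<in> iso G G'" and one: "\<one>\<^bsub>G'\<^esub> = f \<one>\<^bsub>G\<^esub>"
  shows "(G', f ` K, f ` H, f ` E) is_trifact_quotient_of Y"
proof -
  obtain T g where Y: "trifactorised Y" and T: "T \<lhd> fst Y" "trifactorised (quotient_quad Y T)"
    and g: "g \<in> trifact_iso (G, K, H, E) (quotient_quad Y T)"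
    and X: "trifactorised_group G K H E"
    using quot by (auto simp: is_trifact_quotient_def)
  interpret X: trifactorised_group G K H E by (rule X)
  have G': "group G'"
    using X.iso_imp_img_group [OF iso] by (simp flip: one)
  have inv: "inv_into (carrier G) f \<in> iso G' G"
    by (rule X.iso_set_sym [OF iso])
  have inj: "inj_on f (carrier G)"
    using iso by (simp add: iso_iff)
  obtain Q K' H' E' where Q: "quotient_quad Y T = (Q, K', H', E')"
    by (metis prod_cases4)
  note sub = X.factors_subset
  have gQ: "g \<in> iso G Q" and img: "g ` K \<subseteq> K'" "g ` H \<subseteq> H'" "g ` E \<subseteq> E'"
    using g by (auto simp: Q trifact_iso_def iso_def)
  have "g \<circ> inv_into (carrier G) f \<in> iso G' Q"
    by (rule iso_set_trans [OF inv gQ])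
  moreover have "(g \<circ> inv_into (carrier G) f) ` f ` U = g ` U" if "U \<subseteq> carrier G" for U
    by (simp only: image_comp [symmetric] inv_into_image_cancel [OF inj that])
  ultimately have "g \<circ> inv_into (carrier G) f
      \<in> trifact_iso (G', f ` K, f ` H, f ` E) (quotient_quad Y T)"
    using img sub by (simp add: Q trifact_iso_def iso_def)
  then show ?thesis
    using X.iso_image_trifactorised [OF G' iso] Y T by (auto simp: is_trifact_quotient_def)
qed


section \<open>The semidirect product\<close>

lemma semidirect_simps [simp]:
  "carrier (semidirect K E \<phi>) = carrier K \<times> carrier E"
  "(a, x) \<otimes>\<^bsub>semidirect K E \<phi>\<^esub> (b, y) = (a \<otimes>\<^bsub>K\<^esub> \<phi> x b, x \<otimes>\<^bsub>E\<^esub> y)"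
  "\<one>\<^bsub>semidirect K E \<phi>\<^esub> = (\<one>\<^bsub>K\<^esub>, \<one>\<^bsub>E\<^esub>)"
  by (simp_all add: semidirect_def)

text \<open>The left inverse of \<open>(a, x)\<close> is \<open>(\<phi> x\<^sup>-\<^sup>1 (a\<^sup>-\<^sup>1), x\<^sup>-\<^sup>1)\<close>.\<close>

lemma group_semidirect:
  assumes "group K" "group E" and \<phi>: "\<phi> \<in> hom E (AutoGroup K)"
  shows "group (semidirect K E \<phi>)"
proof -
  interpret K: group K by (rule assms)
  interpret E: group E by (rule assms)
  interpret \<phi>: group_hom E "AutoGroup K" \<phi>
    using assms K.AutoGroup by (simp add: group_hom_def group_hom_axioms_def)
  have auto: "\<phi> x \<in> auto K" if "x \<in> carrier E" for x
    using that \<phi>.hom_closed by (simp add: AutoGroup_def)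
  have closed: "\<phi> x a \<in> carrier K" if "x \<in> carrier E" "a \<in> carrier K" for x a
    using that auto [of x] by (auto simp: auto_def hom_def)
  have mult: "\<phi> x (a \<otimes>\<^bsub>K\<^esub> b) = \<phi> x a \<otimes>\<^bsub>K\<^esub> \<phi> x b"
    if "x \<in> carrier E" "a \<in> carrier K" "b \<in> carrier K" for x a b
    using that auto [of x] by (auto simp: auto_def hom_def)
  have act: "\<phi> (x \<otimes>\<^bsub>E\<^esub> y) a = \<phi> x (\<phi> y a)"
    if "x \<in> carrier E" "y \<in> carrier E" "a \<in> carrier K" for x y a
    using that auto [of x] auto [of y]
    by (simp add: AutoGroup_def BijGroup_def auto_def compose_def)
  have one: "\<phi> \<one>\<^bsub>E\<^esub> a = a" if "a \<in> carrier K" for a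
    using that \<phi>.hom_one by (simp add: AutoGroup_def BijGroup_def)
  show ?thesis
  proof (rule groupI)
    fix p assume "p \<in> carrier (semidirect K E \<phi>)"
    then obtain a x where p: "p = (a, x)" "a \<in> carrier K" "x \<in> carrier E"
      by auto
    let ?q = "(\<phi> (inv\<^bsub>E\<^esub> x) (inv\<^bsub>K\<^esub> a), inv\<^bsub>E\<^esub> x)"
    \<comment> \<open>The second instance of \<open>mult\<close>, at \<open>1 \<cdot> 1\<close>, shows that \<open>\<phi> x\<^sup>-\<^sup>1\<close> fixes \<open>1\<close>.\<close>
    have "?q \<otimes>\<^bsub>semidirect K E \<phi>\<^esub> p = \<one>\<^bsub>semidirect K E \<phi>\<^esub>"
      using p mult [of "inv\<^bsub>E\<^esub> x" "inv\<^bsub>K\<^esub> a" a] mult [of "inv\<^bsub>E\<^esub> x" "\<one>\<^bsub>K\<^esub>" "\<one>\<^bsub>K\<^esub>"]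
        closed [of "inv\<^bsub>E\<^esub> x" "\<one>\<^bsub>K\<^esub>"]
      by simp
    with p show "\<exists>q\<in>carrier (semidirect K E \<phi>). q \<otimes>\<^bsub>semidirect K E \<phi>\<^esub> p = \<one>\<^bsub>semidirect K E \<phi>\<^esub>"
      by (intro bexI [of _ ?q]) (auto simp: closed simp del: \<phi>.hom_inv)
  qed (auto simp: closed mult act one K.m_assoc E.m_assoc simp del: \<phi>.hom_mult \<phi>.hom_one)
qed


section \<open>Trifactorised groups associated with a skew left brace\<close>

context skew_left_brace
begin

interpretation A: group "add_monoid B"
  rewrites "carrier (add_monoid B) = carrier B"
    and "mult (add_monoid B) = add B"
    and "one (add_monoid B) = zero B"
    and "m_inv (add_monoid B) = a_inv B"
  by (simp_all add: add_group a_inv_def)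

interpretation M: group B
  by (rule mult_group)

text \<open>
  Because \<open>ker \<eta> \<le> ker \<lambda>\<close>, the homomorphism \<open>\<lambda>\<close> factors through \<open>\<eta>\<close>; the factor
  agrees with \<^term>\<open>lam_bar B \<eta>\<close> on \<open>\<eta> c\<close> for each \<open>c\<close>, hence everywhere on \<open>E\<close>.
\<close>

lemma lam_bar_hom:
  assumes "associated_epi B E \<eta>"
  shows "lam_bar B \<eta> \<in> hom E (AutoGroup (add_monoid B))"
proof -
  have E: "group E" and \<eta>: "\<eta> \<in> epi B E"
    and ker: "kernel B E \<eta> \<subseteq> kernel B (AutoGroup (add_monoid B)) (lam B)"
    using assms by (auto simp: associated_epi_def)
  obtain \<psi> where \<psi>: "\<psi> \<in> hom E (AutoGroup (add_monoid B))"
    "\<And>c. c \<in> carrier B \<Longrightarrow> \<psi> (\<eta> c) = lam B c"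
    using epi_factorisation [OF mult_group E A.AutoGroup \<eta> lam_hom ker] by blast
  have "lam_bar B \<eta> e = \<psi> e" if "e \<in> carrier E" for e
  proof -
    obtain c where "c \<in> carrier B" "e = \<eta> c"
      using \<open>e \<in> carrier E\<close> \<eta> by (auto simp: epi_def)
    then show ?thesis
      using \<psi>(2) lam_bar_eq [OF assms] by simp
  qed
  then show ?thesis
    using \<psi>(1) group.is_monoid [OF E] by (auto simp: hom_def monoid.m_closed)
qed

lemma lam_zero: "a \<in> carrier B \<Longrightarrow> lam B a \<zero> = \<zero>"
  using lam_add [of a \<zero> \<zero>] lam_closed [of a \<zero>] by simp

text \<open>
  \<open>K\<close> is the kernel of the second projection, and \<open>E\<close> the image of the second
  embedding. \<open>H\<close> is the graph of \<open>\<eta>\<close>, and it is a subgroup because \<open>c \<mapsto> (c, \<eta> c)\<close> is a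
  homomorphism on the multiplicative group: \<open>(c, \<eta> c)(d, \<eta> d)\<close> has first coordinate
  \<open>c + \<lambda>\<^sub>c(d) = cd\<close>. Being a graph, \<open>H\<close> meets each coset of \<open>E\<close> (fix the first
  coordinate) and, as \<open>\<eta>\<close> is onto, each coset of \<open>K\<close> (fix the second). It meets \<open>E\<close> only
  in the neutral element because \<open>0 = 1\<close> in \<open>B\<close>, so that \<open>\<eta> 0 = 1\<close>.
\<close>

lemma trifactorised_associated_quad:
  assumes assoc: "associated_epi B E \<eta>"
  shows "trifactorised (associated_quad B E \<eta>)"
proof -
  let ?G = "semidirect (add_monoid B) E (lam_bar B \<eta>)"
  let ?K = "carrier B \<times> {\<one>\<^bsub>E\<^esub>}" and ?H = "{(c, \<eta> c) |c. c \<in> carrier B}"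
    and ?E = "{\<zero>} \<times> carrier E"
  interpret E: group E
    using assoc by (simp add: associated_epi_def)
  interpret \<eta>: group_hom B E \<eta>
    using assoc by unfold_locales (simp add: associated_epi_def epi_def)
  interpret G: group ?G
    using group_semidirect [OF add_group E.is_group lam_bar_hom [OF assoc]] .
  have surj: "\<eta> ` carrier B = carrier E"
    using assoc by (simp add: associated_epi_def epi_def)
  note bar = lam_bar_eq [OF assoc]
  have bar_zero: "lam_bar B \<eta> e \<zero> = \<zero>" if "e \<in> carrier E" for e
  proof -
    obtain c where "c \<in> carrier B" "e = \<eta> c"
      using \<open>e \<in> carrier E\<close> surj by blast
    then show ?thesis
      using bar lam_zero by simp
  qed
  have bar_one: "lam_bar B \<eta> \<one>\<^bsub>E\<^esub> b = b" if "b \<in> carrier B" for b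
    using that bar [of \<one>] lam_one by simp
  have eta_zero: "\<eta> \<zero> = \<one>\<^bsub>E\<^esub>"
    by (simp only: zero_eq_one \<eta>.hom_one)
  interpret snd: group_hom ?G E snd
    by unfold_locales (auto simp: hom_def)
  interpret gr: group_hom B ?G "\<lambda>c. (c, \<eta> c)"
    by unfold_locales (auto simp: hom_def bar simp flip: mult_conv_lam)
  interpret incl: group_hom E ?G "\<lambda>e. (\<zero>, e)"
    by unfold_locales (auto simp: hom_def bar_zero)
  have "trifactorised_group ?G ?K ?H ?E"
  proof (intro trifactorised_group.intro trifactorised_group_axioms.intro G.is_group)
    have "kernel ?G E snd = ?K"
      by (auto simp: kernel_def)
    then show "?K \<lhd> ?G"
      using snd.normal_kernel by simp
    have "(\<lambda>c. (c, \<eta> c)) ` carrier B = ?H"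
      by auto
    then show "subgroup ?H ?G"
      using gr.img_is_subgroup by simp
    have "(\<lambda>e. (\<zero>, e)) ` carrier E = ?E"
      by auto
    then show "subgroup ?E ?G"
      using incl.img_is_subgroup by simp
    then have sub: "?K \<subseteq> carrier ?G" "?H \<subseteq> carrier ?G" "?E \<subseteq> carrier ?G"
      using \<open>subgroup ?H ?G\<close> by auto
    show "carrier ?G = ?K <#>\<^bsub>?G\<^esub> ?E"
    proof
      show "carrier ?G \<subseteq> ?K <#>\<^bsub>?G\<^esub> ?E"
      proof
        fix p assume "p \<in> carrier ?G"
        then have "(fst p, \<one>\<^bsub>E\<^esub>) \<in> ?K" "(\<zero>, snd p) \<in> ?E"
          and "p = (fst p, \<one>\<^bsub>E\<^esub>) \<otimes>\<^bsub>?G\<^esub> (\<zero>, snd p)"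
          by (auto simp: bar_zero)
        then show "p \<in> ?K <#>\<^bsub>?G\<^esub> ?E"
          unfolding set_mult_def by blast
      qed
    qed (rule G.set_mult_closed [OF sub(1,3)])
    show "carrier ?G = ?K <#>\<^bsub>?G\<^esub> ?H"
    proof
      show "carrier ?G \<subseteq> ?K <#>\<^bsub>?G\<^esub> ?H"
      proof
        fix p assume "p \<in> carrier ?G"
        then have "fst p \<in> carrier B" "snd p \<in> \<eta> ` carrier B"
          using surj by auto
        then obtain a c where p: "p = (a, \<eta> c)" and ac: "a \<in> carrier B" "c \<in> carrier B"
          by (cases p) auto
        then have "p = (a \<oplus> \<ominus> c, \<one>\<^bsub>E\<^esub>) \<otimes>\<^bsub>?G\<^esub> (c, \<eta> c)"
          by (simp add: bar_one A.m_assoc)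
        moreover have "(a \<oplus> \<ominus> c, \<one>\<^bsub>E\<^esub>) \<in> ?K" "(c, \<eta> c) \<in> ?H"
          using ac by auto
        ultimately show "p \<in> ?K <#>\<^bsub>?G\<^esub> ?H"
          unfolding set_mult_def by blast
      qed
    qed (rule G.set_mult_closed [OF sub(1,2)])
    show "carrier ?G = ?H <#>\<^bsub>?G\<^esub> ?E"
    proof
      show "carrier ?G \<subseteq> ?H <#>\<^bsub>?G\<^esub> ?E"
      proof
        fix p assume "p \<in> carrier ?G"
        then obtain a e where p: "p = (a, e)" and ae: "a \<in> carrier B" "e \<in> carrier E"
          by auto
        \<comment> \<open>The embedding of \<open>E\<close>, as a rewrite rule, would split the second factor into a product.\<close>
        then have "p = (a, \<eta> a) \<otimes>\<^bsub>?G\<^esub> (\<zero>, inv\<^bsub>E\<^esub> (\<eta> a) \<otimes>\<^bsub>E\<^esub> e)"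
          by (simp add: bar_zero E.m_assoc [symmetric] del: incl.hom_mult incl.hom_inv)
        moreover have "(a, \<eta> a) \<in> ?H" "(\<zero>, inv\<^bsub>E\<^esub> (\<eta> a) \<otimes>\<^bsub>E\<^esub> e) \<in> ?E"
          using ae by (auto simp del: incl.hom_mult incl.hom_inv)
        ultimately show "p \<in> ?H <#>\<^bsub>?G\<^esub> ?E"
          unfolding set_mult_def by blast
      qed
    qed (rule G.set_mult_closed [OF sub(2,3)])
    \<comment> \<open>As rewrite rules these would fold \<open>(0, 1)\<close> back into the neutral element of the product.\<close>
    note [simp del] = incl.hom_one gr.hom_one
    show "?K \<inter> ?E = {\<one>\<^bsub>?G\<^esub>}"
      unfolding semidirect_simps by auto
    show "?H \<inter> ?E = {\<one>\<^bsub>?G\<^esub>}"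
      unfolding semidirect_simps using eta_zero by auto
  qed
  then show ?thesis
    by (simp add: associated_quad_def)
qed

text \<open>
  The induced map \<open>\<psi>\<close> intertwines the two actions, so it extends by the identity on \<open>K\<close>
  to the semidirect products and sends the graph of \<open>\<eta>\<^sub>1\<close> to that of \<open>\<eta>\<^sub>2\<close>.
\<close>

lemma associated_quotient:
  assumes assoc1: "associated_epi B E\<^sub>1 \<eta>\<^sub>1" and assoc2: "associated_epi B E\<^sub>2 \<eta>\<^sub>2"
    and ker: "kernel B E\<^sub>1 \<eta>\<^sub>1 \<subseteq> kernel B E\<^sub>2 \<eta>\<^sub>2"
  shows "associated_quad B E\<^sub>2 \<eta>\<^sub>2 is_trifact_quotient_of associated_quad B E\<^sub>1 \<eta>\<^sub>1"
proof -
  have E1: "group E\<^sub>1" and eta1: "\<eta>\<^sub>1 \<in> epi B E\<^sub>1" and E2: "group E\<^sub>2" and eta2: "\<eta>\<^sub>2 \<in> epi B E\<^sub>2"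
    using assoc1 assoc2 by (auto simp: associated_epi_def)
  then have surj: "\<eta>\<^sub>1 ` carrier B = carrier E\<^sub>1" "\<eta>\<^sub>2 ` carrier B = carrier E\<^sub>2"
    and hom2: "\<eta>\<^sub>2 \<in> hom B E\<^sub>2"
    by (auto simp: epi_def)
  obtain \<psi> where hom: "\<psi> \<in> hom E\<^sub>1 E\<^sub>2"
    and \<psi>: "\<And>c. c \<in> carrier B \<Longrightarrow> \<psi> (\<eta>\<^sub>1 c) = \<eta>\<^sub>2 c"
    using epi_factorisation [OF mult_group E1 E2 eta1 hom2 ker] by blast
  interpret \<psi>: group_hom E\<^sub>1 E\<^sub>2 \<psi>
    using E1 E2 hom by (simp add: group_hom_def group_hom_axioms_def)
  have \<psi>_surj: "\<psi> ` carrier E\<^sub>1 = carrier E\<^sub>2"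
    unfolding surj [symmetric] image_image by (rule image_cong) (simp_all add: \<psi>)
  have bar: "lam_bar B \<eta>\<^sub>2 (\<psi> e) = lam_bar B \<eta>\<^sub>1 e" if "e \<in> carrier E\<^sub>1" for e
  proof -
    obtain c where "c \<in> carrier B" "e = \<eta>\<^sub>1 c"
      using \<open>e \<in> carrier E\<^sub>1\<close> surj(1) by blast
    then show ?thesis
      using \<psi> lam_bar_eq [OF assoc1] lam_bar_eq [OF assoc2] by simp
  qed
  show ?thesis
    unfolding associated_quad_def
  proof (rule trifact_quotient_of_surjection [where f = "map_prod id \<psi>"])
    show "map_prod id \<psi> \<in> hom (semidirect (add_monoid B) E\<^sub>1 (lam_bar B \<eta>\<^sub>1))
        (semidirect (add_monoid B) E\<^sub>2 (lam_bar B \<eta>\<^sub>2))"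
      by (auto simp: hom_def bar)
    show "map_prod id \<psi> ` (carrier B \<times> {\<one>\<^bsub>E\<^sub>1\<^esub>}) = carrier B \<times> {\<one>\<^bsub>E\<^sub>2\<^esub>}"
      by (simp add: map_prod_surj_on)
    have "map_prod id \<psi> ` (\<lambda>c. (c, \<eta>\<^sub>1 c)) ` carrier B = (\<lambda>c. (c, \<eta>\<^sub>2 c)) ` carrier B"
      unfolding image_image by (intro image_cong) (simp_all add: \<psi>)
    then show "map_prod id \<psi> ` {(c, \<eta>\<^sub>1 c) |c. c \<in> carrier B} = {(c, \<eta>\<^sub>2 c) |c. c \<in> carrier B}"
      by (simp only: Setcompr_eq_image)
    show "map_prod id \<psi> ` ({\<zero>} \<times> carrier E\<^sub>1) = {\<zero>} \<times> carrier E\<^sub>2"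
      by (simp add: map_prod_surj_on \<psi>_surj)
  qed (use trifactorised_associated_quad assoc1 assoc2 in \<open>auto simp: associated_quad_def\<close>)
qed

lemma large_quotient:
  assumes "associated_epi B E \<eta>"
  shows "associated_quad B E \<eta> is_trifact_quotient_of large_quad B"
proof -
  interpret \<eta>: group_hom B E \<eta>
    using assms by (simp add: group_hom_def group_hom_axioms_def associated_epi_def epi_def mult_group)
  have "kernel B B id \<subseteq> kernel B E \<eta>"
    by (auto simp: kernel_def)
  then show ?thesis
    unfolding large_quad_def by (rule associated_quotient [OF large_epi assms])
qed

text \<open>
  The small group and the group associated with \<open>\<lambda>\<close> have the same carrier, distinguished
  subgroups and product of elements of the carrier, so the identity map transfers the
  quotient property from the second to the first.
\<close>

lemma small_quotient:
  assumes "associated_epi B E \<eta>"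
  shows "small_quad B is_trifact_quotient_of associated_quad B E \<eta>"
proof -
  obtain S K H L where small: "small_quad B = (S, K, H, L)"
    by (metis prod_cases4)
  obtain S' K' H' L' where asc: "associated_quad B lam_image (lam B) = (S', K', H', L')"
    by (metis prod_cases4)
  have eq: "K' = K" "H' = H" "L' = L" "\<one>\<^bsub>S'\<^esub> = \<one>\<^bsub>S\<^esub>"
    using small asc by (auto simp: small_quad_def associated_quad_def Let_def Hol_def)
  have iso: "(\<lambda>x. x) \<in> iso S S'"
    using small_iso_associated by (simp add: small asc trifact_iso_def iso_def)
  then have carr: "carrier S' = carrier S"
    by (simp add: iso_iff)
  have "x \<otimes>\<^bsub>S'\<^esub> y = x \<otimes>\<^bsub>S\<^esub> y" if "x \<in> carrier S" "y \<in> carrier S" for x y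
    using hom_mult [OF _ that, of "\<lambda>x. x" S'] iso by (simp add: iso_iff)
  moreover have "x \<otimes>\<^bsub>S'\<^esub> y \<in> carrier S'" if "x \<in> carrier S'" "y \<in> carrier S'" for x y
    using trifactorised_associated_quad [OF small_epi] that
    by (simp add: asc trifactorised_group_def group.is_monoid monoid.m_closed)
  ultimately have iso': "(\<lambda>x. x) \<in> iso S' S"
    by (auto simp: iso_iff hom_def carr)
  have ker: "kernel B E \<eta> \<subseteq> kernel B lam_image (lam B)"
    using assms by (auto simp: associated_epi_def kernel_def)
  have "(S', K', H', L') is_trifact_quotient_of associated_quad B E \<eta>"
    using associated_quotient [OF assms small_epi ker] by (simp add: asc)
  from trifact_quotient_iso [OF this iso'] show ?thesis
    by (simp add: eq small)
qed

end

theorem theorem6p11: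
  fixes B :: "'a ring"
  assumes "skew_left_brace B"
  shows
    "(\<forall>(E\<^sub>1 :: 'b monoid) \<eta>\<^sub>1 (E\<^sub>2 :: 'c monoid) \<eta>\<^sub>2.
        associated_epi B E\<^sub>1 \<eta>\<^sub>1 \<longrightarrow> associated_epi B E\<^sub>2 \<eta>\<^sub>2 \<longrightarrow>
        kernel B E\<^sub>1 \<eta>\<^sub>1 \<subseteq> kernel B E\<^sub>2 \<eta>\<^sub>2 \<longrightarrow>
        associated_quad B E\<^sub>2 \<eta>\<^sub>2 is_trifact_quotient_of associated_quad B E\<^sub>1 \<eta>\<^sub>1)
     \<and> (\<forall>(E :: 'b monoid) \<eta>. associated_epi B E \<eta> \<longrightarrow>
        associated_quad B E \<eta> is_trifact_quotient_of large_quad B)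
     \<and> (\<forall>(E :: 'b monoid) \<eta>. associated_epi B E \<eta> \<longrightarrow>
        small_quad B is_trifact_quotient_of associated_quad B E \<eta>)"
proof -
  interpret skew_left_brace B by (rule assms)
  show ?thesis
    using associated_quotient large_quotient small_quotient by blast
qed

end
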